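(* Let $W\colon \mathbb{N}\to\{0,1\}$ be a binary Sturmian word and let $n$ be a positive integer. Then \[ \sum_{\vec w \in F_n(W)} h(\vec w) \equiv n \pmod 2, \] where for $\vec w=(w_1,\dots,w_n)\in\{0,1\}^n$, $h(\vec w)$ denotes the number of indices $j$ with $w_j=1$.
   Context: Here $\mathbb{N}=\{0,1,2,\dots\}$. A binary word is a map $W\colon\mathbb{N}\to\{0,1\}$. For $n\ge1$, the set of factors of $W$ of length $n$ is $F_n(W):=\{(W(i),W(i+1),\dots,W(i+n-1))\colon i\ge 0\}\subseteq\{0,1\}^n$. The word $W$ is Sturmian if $|F_n(W)|=n+1$ for every $n\ge 1$. The quantity $h(\vec w)$ (the height, or Hamming weight) is the number of components of $\vec w$ equal to $1$. *)

theory Defs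
  imports Main "HOL-Number_Theory.Cong"
begin

definition binary_word :: "(nat \<Rightarrow> nat) \<Rightarrow> bool" where
  "binary_word W \<longleftrightarrow> range W \<subseteq> {0, 1}"

(* Tuples are lists, so the component with index j in 1..n is the list entry j - 1. *)
definition factors :: "(nat \<Rightarrow> nat) \<Rightarrow> nat \<Rightarrow> nat list set" where
  "factors W n = {map W [i..<i + n] | i. True}"

definition sturmian :: "(nat \<Rightarrow> nat) \<Rightarrow> bool" where
  "sturmian W \<longleftrightarrow> (\<forall>n\<ge>1. card (factors W n) = n + 1)"

definition height :: "nat list \<Rightarrow> nat" where
  "height w = card {j. j < length w \<and> w ! j = 1}"

end

theory Submission
  imports Defs
begin

text \<open>
  A minimal pair of equally long factors whose heights differ by at least 2 has the form
  \<open>0w0\<close>, \<open>1w1\<close> with \<open>w\<close> a palindrome. If \<open>aw\<close> is the right special factor of its length and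
  \<open>b \<noteq> a\<close>, then \<open>aw\<close> does not begin inside an occurrence of \<open>bwb\<close>, so by pigeonhole \<open>W\<close> enters
  a cycle of factors with a forced continuation and is eventually periodic, which is absurd. Hence
  \<open>W\<close> is balanced. Its language together with all reversals is still balanced, and a balanced
  language has at most \<open>n + 1\<close> words of length \<open>n\<close>; so the language is closed under reversal.

  Let \<open>R\<^sub>n\<close> be the right special factor of length \<open>n\<close> and \<open>S\<^sub>n\<close> the sum of heights. Extending
  factors to the right gives \<open>S\<^sub>n\<^sub>+\<^sub>1 = S\<^sub>n + h(R\<^sub>n) + D\<close>, where \<open>D\<close> counts the factors of length
  \<open>n + 1\<close> ending in 1. By reversal \<open>D\<close> counts those beginning with 1, and this number grows from
  \<open>n\<close> to \<open>n + 1\<close> by the first letter of \<open>R\<^sub>n\<close>, so that \<open>D = 1 + h(R\<^sub>n)\<close> and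
  \<open>S\<^sub>n\<^sub>+\<^sub>1 = S\<^sub>n + 2 h(R\<^sub>n) + 1\<close>.
\<close>

section \<open>Binary languages\<close>

declare One_nat_def [simp del] upt_Suc [simp del]

lemma height_conv_count_list: "height w = count_list w 1"
  by (simp add: height_def count_list_eq_length_filter length_filter_conv_card eq_commute[of "1 :: nat"])

lemma height_simps [simp]:
  "height [] = 0"
  "height (a # u) = (if a = 1 then 1 else 0) + height u"
  "height (u @ v) = height u + height v"
  "height (rev u) = height u"
  by (simp_all add: height_conv_count_list)

text \<open>Abstracted because two such languages occur: the factors of \<open>W\<close>, and these
  together with all their reversals.\<close>

locale binary_language =
  fixes X :: "nat list set"
  assumes letters: "u \<in> X \<Longrightarrow> set u \<subseteq> {0, 1}"
    and prefix: "u @ v \<in> X \<Longrightarrow> u \<in> X"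
    and suffix: "u @ v \<in> X \<Longrightarrow> v \<in> X"
begin

definition level :: "nat \<Rightarrow> nat list set" where
  "level n = {u \<in> X. length u = n}"

text \<open>The intersection of \<open>ext 0 n\<close> and \<open>ext 1 n\<close> is the set of
  right special words of length \<open>n\<close>.\<close>

definition ext :: "nat \<Rightarrow> nat \<Rightarrow> nat list set" where
  "ext a n = {u. length u = n \<and> u @ [a] \<in> X}"

definition balanced :: bool where
  "balanced \<longleftrightarrow> (\<forall>u\<in>X. \<forall>v\<in>X. length u = length v \<longrightarrow> height v \<le> height u + 1)"

lemma finite_level [simp]: "finite (level n)"
proof (rule finite_subset)
  show "level n \<subseteq> {u. set u \<subseteq> {0, 1} \<and> length u = n}"
    using letters by (auto simp: level_def)
qed (rule finite_lists_length_eq, simp)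

lemma ext_subset_level: "ext a n \<subseteq> level n"
  using prefix by (auto simp: ext_def level_def)

lemma finite_ext [simp]: "finite (ext a n)"
  using finite_subset[OF ext_subset_level finite_level] .

lemma level_Suc: "level (Suc n) = (\<lambda>u. u @ [0]) ` ext 0 n \<union> (\<lambda>u. u @ [1]) ` ext 1 n"
proof (intro equalityI subsetI)
  fix w assume w: "w \<in> level (Suc n)"
  then obtain u a where ua: "w = u @ [a]"
    by (cases w rule: rev_cases) (auto simp: level_def)
  with w letters[of w] have "a = 0 \<or> a = 1"
    by (auto simp: level_def)
  with w ua show "w \<in> (\<lambda>u. u @ [0]) ` ext 0 n \<union> (\<lambda>u. u @ [1]) ` ext 1 n"
    by (auto simp: level_def ext_def)
qed (auto simp: level_def ext_def)

lemma sum_level_Suc: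
  fixes g :: "nat list \<Rightarrow> nat"
  shows "sum g (level (Suc n)) = (\<Sum>u\<in>ext 0 n. g (u @ [0])) + (\<Sum>u\<in>ext 1 n. g (u @ [1]))"
proof -
  have "sum g (level (Suc n))
      = sum g ((\<lambda>u. u @ [0]) ` ext 0 n) + sum g ((\<lambda>u. u @ [1]) ` ext 1 n)"
    unfolding level_Suc by (rule sum.union_disjoint) auto
  also have "\<dots> = (\<Sum>u\<in>ext 0 n. g (u @ [0])) + (\<Sum>u\<in>ext 1 n. g (u @ [1]))"
    by (simp add: sum.reindex inj_on_def)
  finally show ?thesis .
qed

lemma card_level_Suc: "card (level (Suc n)) = card (ext 0 n \<union> ext 1 n) + card (ext 0 n \<inter> ext 1 n)"
  using sum_level_Suc[of "\<lambda>_. 1" n] card_Un_Int[of "ext 0 n" "ext 1 n"] by simp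

lemma right_special_suffix:
  "u @ v \<in> ext 0 m \<inter> ext 1 m \<Longrightarrow> v \<in> ext 0 (length v) \<inter> ext 1 (length v)"
  using suffix[of u "v @ [0]"] suffix[of u "v @ [1]"] by (auto simp: ext_def)

section \<open>Balanced languages\<close>

lemma balanced_right_special_unique:
  assumes balanced "u \<in> ext 0 n \<inter> ext 1 n" "v \<in> ext 0 n \<inter> ext 1 n"
  shows "u = v"
proof (rule ccontr)
  assume "u \<noteq> v"
  \<comment> \<open>Reversing exposes the longest common suffix \<open>s\<close>. It is preceded by
    different letters, and both words extend by both letters, so \<open>0s0\<close> and
    \<open>1s1\<close> lie in \<open>X\<close>, with heights 2 apart.\<close>
  then have "rev u \<noteq> rev v" and "length (rev u) = length (rev v)"
    using assms by (auto simp: ext_def)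
  then obtain p x q y q' where "x \<noteq> y" and *: "rev u = p @ [x] @ q" "rev v = p @ [y] @ q'"
    using same_length_different[of "rev u" "rev v"] by blast
  define s where "s = rev p"
  have u: "u = rev q @ [x] @ s" and v: "v = rev q' @ [y] @ s"
    using arg_cong[OF *(1), of rev] arg_cong[OF *(2), of rev] by (simp_all add: s_def)
  have fac: "[x] @ s @ [c] \<in> X" "[y] @ s @ [c] \<in> X" if "c = 0 \<or> c = 1" for c
    using that assms(2,3) suffix[of "rev q" "[x] @ s @ [c]"] suffix[of "rev q'" "[y] @ s @ [c]"]
    by (auto simp: ext_def u v)
  have "x \<in> {0, 1}" "y \<in> {0, 1}"
    using letters[OF fac(1)[of 0]] letters[OF fac(2)[of 0]] by auto
  then have "[0] @ s @ [0] \<in> X" "[1] @ s @ [1] \<in> X"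
    using fac[of 0] fac[of 1] \<open>x \<noteq> y\<close> by auto
  with \<open>balanced\<close> have "height ([1] @ s @ [1]) \<le> height ([0] @ s @ [0]) + 1"
    unfolding balanced_def by (metis length_append length_Cons)
  then show False by simp
qed

text \<open>At most one word of each length has two right extensions, so each step adds at most one
  word.\<close>

lemma card_level_le:
  assumes balanced
  shows "card (level n) \<le> n + 1"
proof (induction n)
  case 0
  have "level 0 \<subseteq> {[]}" by (auto simp: level_def)
  then show ?case using card_mono[of "{[]}" "level 0"] by simp
next
  case (Suc n)
  have "\<forall>u\<in>ext 0 n \<inter> ext 1 n. \<forall>v\<in>ext 0 n \<inter> ext 1 n. u = v"
    using balanced_right_special_unique[OF assms] by blast
  then have "card (ext 0 n \<inter> ext 1 n) \<le> 1"
    using card_le_Suc0_iff_eq[of "ext 0 n \<inter> ext 1 n"] by (simp add: One_nat_def)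
  moreover have "card (ext 0 n \<union> ext 1 n) \<le> card (level n)"
    using ext_subset_level by (intro card_mono) auto
  ultimately show ?case using Suc card_level_Suc[of n] by linarith
qed

lemma minimal_unbalanced_pair:
  assumes "\<not> balanced"
  obtains w where "[0] @ w @ [0] \<in> X" "[1] @ w @ [1] \<in> X" "rev w = w"
proof -
  define P where "P n \<longleftrightarrow> (\<exists>u\<in>X. \<exists>v\<in>X. length u = n \<and> length v = n \<and> height v \<ge> height u + 2)" for n
  have "\<exists>n. P n"
    using assms unfolding balanced_def P_def by (force simp: not_le)
  define n where "n = (LEAST n. P n)"
  have "P n" using \<open>\<exists>n. P n\<close> unfolding n_def by (rule LeastI_ex)
  then obtain u v where uv: "u \<in> X" "v \<in> X" "length u = n" "length v = n" "height v \<ge> height u + 2"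
    by (auto simp: P_def)
  have minimal: "height v' \<le> height u' + 1"
    if "u' \<in> X" "v' \<in> X" "length u' = length v'" "length v' < n" for u' v'
  proof -
    have "\<not> P (length v')" using not_less_Least that(4) unfolding n_def by blast
    then show ?thesis using that unfolding P_def by force
  qed
  obtain a u1 b v1 where 1: "u = [a] @ u1" "v = [b] @ v1"
    using uv by (cases u; cases v) auto
  \<comment> \<open>Deleting the first letters leaves a shorter pair, so by minimality these letters
    carry part of the excess; the last letters are treated alike.\<close>
  have h1: "height v1 \<le> height u1 + 1"
    using uv 1 suffix[of "[a]" u1] suffix[of "[b]" v1] by (intro minimal) auto
  then have ab: "a \<noteq> 1" "b = 1" using uv(5) 1 by (auto split: if_splits)
  then have "length v1 \<noteq> 0" "length u1 = length v1" using uv 1 by auto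
  then obtain w c w' d where 2: "u1 = w @ [c]" "v1 = w' @ [d]"
    by (cases u1 rule: rev_cases; cases v1 rule: rev_cases) auto
  have h2: "height ([b] @ w') \<le> height ([a] @ w) + 1"
    using uv 1 2 prefix[of "a # w" "[c]"] prefix[of "b # w'" "[d]"] by (intro minimal) auto
  then have cd: "c \<noteq> 1" "d = 1" "height w' = height w"
    using uv(5) 1 2 ab h1 by (auto split: if_splits)
  have "a = 0" "c = 0" using letters[OF uv(1)] 1 2 ab cd by auto
  have u: "u = [0] @ w @ [0]" and v: "v = [1] @ w' @ [1]"
    using 1 2 ab cd \<open>a = 0\<close> \<open>c = 0\<close> by auto
  have len: "length w = length w'" "n = length w + 2" using uv u v by auto
  have "w = w'"
  proof (rule ccontr)
    assume "w \<noteq> w'"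
    then obtain p x q y q' where "x \<noteq> y" and *: "w = p @ [x] @ q" "w' = p @ [y] @ q'"
      using same_length_different[OF _ len(1)] by blast
    have "x \<in> {0, 1}" "y \<in> {0, 1}" using letters[OF uv(1)] letters[OF uv(2)] u v * by auto
    then consider "x = 0" "y = 1" | "x = 1" "y = 0" using \<open>x \<noteq> y\<close> by auto
    then show False
    proof cases
      case 1
      have "height ([1] @ p @ [1]) \<le> height ([0] @ p @ [0]) + 1"
        using uv(1,2) u v * 1 len prefix[of "[0] @ p @ [0]" "q @ [0]"]
          prefix[of "[1] @ p @ [1]" "q' @ [1]"] by (intro minimal) auto
      then show False by simp
    next
      case 2
      \<comment> \<open>Since \<open>w\<close> and \<open>w'\<close> have equal height,
        \<open>q'\<close> has one more 1 than \<open>q\<close>, so these tails already differ by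
        2.\<close>
      have "height (q' @ [1]) \<le> height (q @ [0]) + 1"
        using uv(1,2) u v * 2 len suffix[of "[0] @ p @ [x]" "q @ [0]"]
          suffix[of "[1] @ p @ [y]" "q' @ [1]"] by (intro minimal) auto
      then show False using cd(3) * 2 by simp
    qed
  qed
  have "rev w = w"
  proof (rule ccontr)
    assume "rev w \<noteq> w"
    then obtain p x q y q' where "x \<noteq> y" and *: "w = p @ [x] @ q" "rev w = p @ [y] @ q'"
      using same_length_different[of w "rev w"] by fastforce
    have w: "w = rev q' @ [y] @ rev p" using arg_cong[OF *(2), of rev] by simp
    \<comment> \<open>\<open>w\<close> begins with \<open>p x\<close> and ends with
      \<open>y rev p\<close>, and it occurs enclosed by either letter. Taking \<open>z = x\<close>
      on the left and \<open>z = y\<close> on the right gives a shorter unbalanced pair.\<close>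
    have pre: "[z] @ p @ [x] \<in> X" and suf: "[y] @ rev p @ [z] \<in> X" if "z = 0 \<or> z = 1" for z
    proof -
      have z: "[z] @ w @ [z] \<in> X" using that uv(1,2) u v \<open>w = w'\<close> by auto
      show "[z] @ p @ [x] \<in> X"
        using z * prefix[of "[z] @ p @ [x]" "q @ [z]"] by auto
      show "[y] @ rev p @ [z] \<in> X"
        using z suffix[of "[z] @ rev q'" "[y] @ rev p @ [z]"] unfolding w by auto
    qed
    have short: "length p + 2 < n" using * len by auto
    have "x \<in> {0, 1}" "y \<in> {0, 1}"
      using letters[OF pre[of 0]] letters[OF suf[of 0]] by auto
    then consider "x = 0" "y = 1" | "x = 1" "y = 0" using \<open>x \<noteq> y\<close> by auto
    then show False
    proof cases
      case 1
      have "height ([1] @ rev p @ [1]) \<le> height ([0] @ p @ [0]) + 1"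
        using pre[of 0] suf[of 1] 1 short by (intro minimal) auto
      then show False by simp
    next
      case 2
      have "height ([1] @ p @ [1]) \<le> height ([0] @ rev p @ [0]) + 1"
        using pre[of 1] suf[of 0] 2 short by (intro minimal) auto
      then show False by simp
    qed
  qed
  with that show ?thesis using uv(1,2) u v \<open>w = w'\<close> by blast
qed

end

section \<open>The language of a Sturmian word\<close>

locale sturmian_word =
  fixes W :: "nat \<Rightarrow> nat"
  assumes binary: "binary_word W" and sturmian: "sturmian W"
begin

abbreviation window :: "nat \<Rightarrow> nat \<Rightarrow> nat list" where
  "window n k \<equiv> map W [k..<k + n]"

definition lang :: "nat list set" where
  "lang = {u. u \<in> factors W (length u)}"

lemma mem_lang: "u \<in> lang \<longleftrightarrow> (\<exists>k. u = window (length u) k)"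
  by (auto simp: lang_def factors_def)

lemma window_in_lang [simp]: "window n k \<in> lang"
  by (auto simp: mem_lang)

lemma window_append: "window (m + n) k = window m k @ window n (k + m)"
  using upt_add_eq_append[of k "k + m" n] by (simp add: add.assoc)

lemma window_Suc: "window (Suc n) k = window n k @ [W (k + n)]"
  by (simp add: upt_Suc)

lemma letter: "W k = 0 \<or> W k = 1"
  using binary by (auto simp: binary_word_def)

sublocale binary_language lang
proof
  show "set u \<subseteq> {0, 1}" if "u \<in> lang" for u
  proof -
    obtain k where "u = window (length u) k" using \<open>u \<in> lang\<close> mem_lang by blast
    then have "set u \<subseteq> range W" by (metis image_mono list.set_map subset_UNIV)
    then show ?thesis using binary by (auto simp: binary_word_def)
  qed
  show "u \<in> lang" "v \<in> lang" if uv: "u @ v \<in> lang" for u v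
  proof -
    obtain k where "u @ v = window (length u + length v) k"
      using uv mem_lang[of "u @ v"] by auto
    then have "u = window (length u) k \<and> v = window (length v) (k + length u)"
      unfolding window_append by simp
    then show "u \<in> lang" "v \<in> lang" using window_in_lang by metis+
  qed
qed

lemma level_eq_factors: "level n = factors W n"
  unfolding level_def by (auto simp: lang_def factors_def)

lemma window_in_level: "window n k \<in> level n"
  unfolding level_eq_factors factors_def by blast

lemma card_level: "card (level n) = n + 1"
proof (cases n)
  case 0
  have "level 0 = {[]}" using window_in_lang[of 0 0] by (auto simp: level_def)
  then show ?thesis using 0 by simp
next
  case (Suc m)
  then show ?thesis using sturmian by (auto simp: level_eq_factors sturmian_def)
qed

section \<open>Right special factors\<close>

lemma ext_union: "ext 0 n \<union> ext 1 n = level n"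
proof
  show "level n \<subseteq> ext 0 n \<union> ext 1 n"
  proof
    fix u assume "u \<in> level n"
    then obtain k where k: "u = window n k" by (auto simp: level_def mem_lang)
    then have "u @ [W (k + n)] \<in> lang" using window_in_lang[of k "Suc n"] by (simp only: window_Suc)
    then show "u \<in> ext 0 n \<union> ext 1 n" using letter[of "k + n"] k by (auto simp: ext_def)
  qed
qed (use ext_subset_level in auto)

lemma card_right_special: "card (ext 0 n \<inter> ext 1 n) = 1"
  using card_level_Suc[of n] by (simp add: ext_union card_level)

definition R :: "nat \<Rightarrow> nat list" where
  "R n = the_elem (ext 0 n \<inter> ext 1 n)"

lemma right_special_eq: "ext 0 n \<inter> ext 1 n = {R n}"
  using card_right_special[of n] unfolding R_def by (metis card_1_singletonE the_elem_eq)

lemma length_R [simp]: "length (R n) = n"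
  using right_special_eq[of n] by (auto simp: ext_def)

text \<open>Suffixes of right special factors are right special, so uniqueness nests the
  \<open>R n\<close>.\<close>

lemma R_Suc: "\<exists>a. R (Suc n) = a # R n"
proof -
  obtain a v where av: "R (Suc n) = a # v"
    using length_R[of "Suc n"] by (cases "R (Suc n)") auto
  then have "[a] @ v \<in> ext 0 (Suc n) \<inter> ext 1 (Suc n)"
    by (simp add: right_special_eq)
  then have "v \<in> ext 0 (length v) \<inter> ext 1 (length v)" by (rule right_special_suffix)
  moreover have "length v = n" using length_R[of "Suc n"] av by simp
  ultimately show ?thesis using av right_special_eq by auto
qed

section \<open>Aperiodicity and balance\<close>

lemma not_eventually_periodic:
  assumes "p > 0" and per: "\<And>k. k \<ge> s \<Longrightarrow> W (k + p) = W k"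
  shows False
proof -
  \<comment> \<open>A window starting at or beyond \<open>s + p\<close> equals the one
    \<open>p\<close> places earlier, so there are at most \<open>s + p\<close> factors of length
    \<open>s + p\<close>, one too few.\<close>
  let ?m = "s + p"
  have "window ?m k \<in> window ?m ` {..<?m}" for k
  proof (induction k rule: less_induct)
    case (less k)
    show ?case
    proof (cases "k < ?m")
      case False
      have "window ?m k = window ?m (k - p)"
      proof (rule nth_equalityI)
        fix j assume "j < length (window ?m k)"
        then show "window ?m k ! j = window ?m (k - p) ! j"
          using per[of "k - p + j"] False by (simp add: algebra_simps)
      qed simp
      then show ?thesis using less[of "k - p"] False \<open>p > 0\<close> by simp
    qed auto
  qed
  then have "level ?m \<subseteq> window ?m ` {..<?m}"
    by (auto simp: level_eq_factors factors_def)
  then have "card (level ?m) \<le> card (window ?m ` {..<?m})"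
    by (intro card_mono) auto
  also have "\<dots> \<le> ?m"
    using card_image_le[of "{..<?m}" "window ?m"] by simp
  finally have "card (level ?m) \<le> ?m" .
  then show False by (simp add: card_level)
qed

text \<open>Every other factor of this length has a single right extension, so a cycle avoiding
  \<open>R (Suc n)\<close> would make \<open>W\<close> periodic from \<open>s\<close> on with period
  \<open>t - s\<close>.\<close>

lemma cycle_meets_right_special:
  assumes "s < t" "window (Suc n) s = window (Suc n) t"
  shows "\<exists>k\<in>{s..<t}. window (Suc n) k = R (Suc n)"
proof (rule ccontr)
  let ?N = "Suc n"
  assume "\<not> ?thesis"
  then have avoid: "window ?N k \<noteq> R ?N" if "s \<le> k" "k < t" for k using that by auto
  define p where "p = t - s"
  have p: "p > 0" "t = s + p" using assms by (auto simp: p_def)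
  \<comment> \<open>Both claims are carried together: equality moves right through the forced
    letter, which needs avoidance, and avoidance at \<open>k >= t\<close> is inherited from
    \<open>k - p\<close>.\<close>
  have cyc: "window ?N k = window ?N (k + p) \<and> window ?N k \<noteq> R ?N" if "k \<ge> s" for k
    using that
  proof (induction k rule: less_induct)
    case (less k)
    have "window ?N k \<noteq> R ?N"
    proof (cases "k < t")
      case False
      then obtain l where "k = l + p" "s \<le> l" "l < k"
        using p that[of "k - p"] by auto
      then show ?thesis using less.IH[of l] by metis
    qed (use avoid less in auto)
    moreover have "window ?N k = window ?N (k + p)"
    proof (cases "k = s")
      case False
      then obtain j where j: "k = Suc j" "j \<ge> s" using less.prems by (cases k) auto
      have IH: "window ?N j = window ?N (j + p)" "window ?N j \<noteq> R ?N"
        using less.IH[of j] j by auto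
      have step: "W (j + ?N) = W (j + p + ?N)"
      proof (rule ccontr)
        assume ne: "W (j + ?N) \<noteq> W (j + p + ?N)"
        have "window ?N j @ [W (j + ?N)] \<in> lang" "window ?N j @ [W (j + p + ?N)] \<in> lang"
          using window_in_lang[of j "Suc ?N"] window_in_lang[of "j + p" "Suc ?N"]
          unfolding window_Suc[of _ ?N] IH(1)[symmetric] by blast+
        then have "window ?N j \<in> ext 0 ?N \<inter> ext 1 ?N"
          using ne letter[of "j + ?N"] letter[of "j + p + ?N"] by (auto simp: ext_def)
        then show False using IH(2) right_special_eq by auto
      qed
      have shift: "W i # window ?N (Suc i) = window ?N i @ [W (i + ?N)]" for i
        using upt_conv_Cons[of i "i + Suc ?N"] window_Suc[of i ?N] by (simp del: upt_Suc)
      have "W j # window ?N (Suc j) = W (j + p) # window ?N (Suc (j + p))"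
        unfolding shift using IH(1) step by simp
      then show ?thesis using j by simp
    qed (use assms p in simp)
    ultimately show ?case by blast
  qed
  have "W (k + p) = W k" if "k \<ge> s" for k
    using cyc[OF that] by (simp add: upt_conv_Cons)
  then show False using not_eventually_periodic[OF \<open>p > 0\<close>] by blast
qed

lemma balanced: balanced
proof (rule ccontr)
  assume "\<not> balanced"
  then obtain w where w: "[0] @ w @ [0] \<in> lang" "[1] @ w @ [1] \<in> lang" "rev w = w"
    by (rule minimal_unbalanced_pair)
  define n where "n = length w"
  have "w \<in> ext 0 n \<inter> ext 1 n"
    using w(1,2) suffix[of "[0]" "w @ [0]"] suffix[of "[1]" "w @ [1]"] by (auto simp: ext_def n_def)
  then have "w = R n" using right_special_eq by auto
  then obtain a where a: "R (Suc n) = a # w" using R_Suc[of n] by auto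
  define b where "b = 1 - a"
  have "a \<in> {0, 1}"
    using right_special_eq[of "Suc n"] ext_subset_level[of 0 "Suc n"] letters[of "a # w"] a
    by (auto simp: level_def)
  then have ab: "a \<noteq> b" "b = 0 \<or> b = 1" by (auto simp: b_def)
  \<comment> \<open>Whichever letter \<open>b\<close> is, this is one word of the minimal
    pair.\<close>
  then have "[b] @ w @ [b] \<in> lang" using w by auto
  moreover have "length ([b] @ w @ [b]) = n + 2" by (simp add: n_def)
  ultimately obtain i where i: "[b] @ w @ [b] = window (n + 2) i"
    unfolding mem_lang by metis
  have Wi: "W (i + j) = ([b] @ w @ [b]) ! j" if "j < n + 2" for j
    unfolding i using that by simp
  have pal: "w ! j = w ! (n - Suc j)" if "j < n" for j
    using rev_nth[of j w] that w(3) by (simp add: n_def)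
  \<comment> \<open>An occurrence starts with \<open>a\<close>, so \<open>k\<close> is neither end
    of \<open>bwb\<close>. With \<open>k = Suc l\<close> it gives \<open>w ! l = a\<close>, while
    the final \<open>b\<close> of \<open>bwb\<close> falls on the mirror position
    \<open>n - Suc l\<close>, against the palindrome.\<close>
  have avoid: "window (Suc n) (i + k) \<noteq> a # w" if k: "k \<le> Suc n" for k
  proof
    assume "window (Suc n) (i + k) = a # w"
    then have win: "W (i + k + j) = (a # w) ! j" if "j \<le> n" for j
      using that nth_map_upt[of j "i + k + Suc n" "i + k" W] by simp
    have first: "W (i + k) = a" using win[of 0] by simp
    then have "k \<noteq> 0" "k \<noteq> Suc n"
      using Wi[of k] ab(1) by (auto simp: nth_append n_def intro!: gr0I)
    then obtain l where l: "k = Suc l" "l < n" using k by (cases k) auto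
    have "w ! l = a" using first Wi[of k] l by (simp add: nth_append n_def)
    moreover have "w ! (n - Suc l) = b"
    proof -
      have "w ! (n - Suc l) = W (i + k + Suc (n - Suc l))"
        using win[of "Suc (n - Suc l)"] l by simp
      also have "i + k + Suc (n - Suc l) = i + Suc n" using l by simp
      also have "W (i + Suc n) = b" using Wi[of "Suc n"] by (simp add: nth_append n_def)
      finally show ?thesis .
    qed
    ultimately show False using pal[of l] l ab by simp
  qed
  \<comment> \<open>The \<open>n + 2\<close> starting positions share the \<open>n + 1\<close>
    factors other than \<open>a # w\<close>, so two windows agree, and the cycle between them must
    meet \<open>a # w\<close>.\<close>
  let ?f = "\<lambda>k. window (Suc n) (i + k)"
  have sub: "?f ` {..Suc n} \<subseteq> level (Suc n) - {a # w}"
  proof (rule image_subsetI)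
    fix k assume "k \<in> {..Suc n}"
    then show "?f k \<in> level (Suc n) - {a # w}"
      using avoid[of k] window_in_level[of "i + k" "Suc n"] by simp
  qed
  have "a # w \<in> level (Suc n)"
    using right_special_eq[of "Suc n"] ext_subset_level[of 0 "Suc n"] a by auto
  then have "card (level (Suc n) - {a # w}) < card {..Suc n}" by (simp add: card_level)
  then have "card (?f ` {..Suc n}) < card {..Suc n}"
    using card_mono[OF _ sub] by fastforce
  then have "\<not> inj_on ?f {..Suc n}" by (rule pigeonhole)
  then obtain x y where xy: "x < y" "y \<le> Suc n" "?f x = ?f y"
    unfolding inj_on_def by (metis atMost_iff linorder_neqE_nat)
  then obtain k where "k \<in> {i + x..<i + y}" "window (Suc n) k = a # w"
    using cycle_meets_right_special[of "i + x" "i + y" n] a by auto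
  moreover from this have "k - i \<le> Suc n" "i + (k - i) = k" using xy by auto
  ultimately show False using avoid[of "k - i"] by simp
qed

section \<open>Closure under reversal\<close>

lemma rev_in_lang: "u \<in> lang \<Longrightarrow> rev u \<in> lang"
proof -
  assume u: "u \<in> lang"
  interpret Y: binary_language "lang \<union> rev ` lang"
  proof
    have mem: "u \<in> lang \<union> rev ` lang \<longleftrightarrow> u \<in> lang \<or> rev u \<in> lang" for u
      by (metis (no_types, lifting) UnE UnI1 UnI2 image_iff rev_rev_ident)
    show "set u \<subseteq> {0, 1}" if "u \<in> lang \<union> rev ` lang" for u
      using that letters[of u] letters[of "rev u"] mem by auto
    show "u \<in> lang \<union> rev ` lang" if "u @ v \<in> lang \<union> rev ` lang" for u v
      using that prefix[of u v] suffix[of "rev v" "rev u"] unfolding mem by auto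
    show "v \<in> lang \<union> rev ` lang" if "u @ v \<in> lang \<union> rev ` lang" for u v
      using that suffix[of u v] prefix[of "rev v" "rev u"] unfolding mem by auto
  qed
  have "Y.balanced"
    using balanced unfolding Y.balanced_def balanced_def by auto
  \<comment> \<open>The balanced union has at most \<open>length u + 1\<close> words of this length,
    and \<open>lang\<close> alone already supplies that many.\<close>
  then have "card (Y.level (length u)) \<le> card (level (length u))"
    using Y.card_level_le card_level by simp
  moreover have "level (length u) \<subseteq> Y.level (length u)"
    by (auto simp: level_def Y.level_def)
  ultimately have "level (length u) = Y.level (length u)"
    by (intro card_seteq) auto
  moreover have "rev u \<in> Y.level (length u)" using u by (auto simp: Y.level_def)
  ultimately show ?thesis by (auto simp: level_def)
qed

section \<open>Counting extensions\<close>

text \<open>Every factor extends to the right, and only \<open>R n\<close> does so in both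
  ways.\<close>

lemma sum_ext:
  fixes f :: "nat list \<Rightarrow> nat"
  shows "sum f (ext 0 n) + sum f (ext 1 n) = sum f (level n) + f (R n)"
  using sum.union_inter[of "ext 0 n" "ext 1 n" f] by (simp add: ext_union right_special_eq)

lemma level_1: "level 1 = {[0], [1]}"
proof (rule card_subset_eq)
  show "level 1 \<subseteq> {[0], [1]}"
  proof
    fix w assume w: "w \<in> level 1"
    then obtain a where "w = [a]" by (cases w) (auto simp: level_def)
    then show "w \<in> {[0], [1]}" using w letters[of w] by (auto simp: level_def)
  qed
qed (auto simp: card_level)

text \<open>Letters are numbers, so the sum counts the words beginning with 1. Passing to the next
  length duplicates only the first letter of the right special factor.\<close>

lemma sum_hd: "(\<Sum>w\<in>level (Suc n). hd w) = 1 + height (R n)"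
proof (induction n)
  case 0
  show ?case using level_1 length_R[of 0] by (simp add: One_nat_def del: length_R)
next
  case (Suc n)
  obtain a where a: "R (Suc n) = a # R n" using R_Suc by blast
  have "a \<in> {0, 1}"
    using right_special_eq[of "Suc n"] ext_subset_level[of 0 "Suc n"] letters[of "a # R n"] a
    by (auto simp: level_def)
  \<comment> \<open>Appending preserves \<open>hd\<close> only for nonempty \<open>u\<close>, hence
    the base case at \<open>level 1\<close>.\<close>
  have hd: "(\<Sum>u\<in>ext c (Suc n). hd (u @ [c])) = (\<Sum>u\<in>ext c (Suc n). hd u)" for c
    by (rule sum.cong) (auto simp: ext_def hd_append)
  have "(\<Sum>w\<in>level (Suc (Suc n)). hd w) = (\<Sum>w\<in>level (Suc n). hd w) + a"
    unfolding sum_level_Suc[of _ "Suc n"] hd sum_ext by (simp add: a)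
  then show ?case using Suc a \<open>a \<in> {0, 1}\<close> by auto
qed

lemma sum_last: "(\<Sum>w\<in>level n. last w) = (\<Sum>w\<in>level n. hd w)"
  by (rule sum.reindex_bij_witness[of _ rev rev])
    (auto simp: level_def rev_in_lang hd_rev)

lemma sum_height_Suc:
  "(\<Sum>w\<in>level (Suc n). height w) = (\<Sum>w\<in>level n. height w) + 2 * height (R n) + 1"
proof -
  \<comment> \<open>Summing last letters counts the words \<open>u @ [1]\<close>; reversal turns
    them into first letters.\<close>
  have "card (ext 1 n) = (\<Sum>w\<in>level (Suc n). last w)"
    by (simp add: sum_level_Suc)
  also have "\<dots> = 1 + height (R n)"
    by (simp only: sum_last sum_hd)
  finally have "card (ext 1 n) = 1 + height (R n)" .
  moreover have "(\<Sum>w\<in>level (Suc n). height w)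
      = sum height (ext 0 n) + sum height (ext 1 n) + card (ext 1 n)"
    by (simp add: sum_level_Suc sum.distrib)
  ultimately show ?thesis by (simp add: sum_ext)
qed

lemma sum_height_cong: "[(\<Sum>w\<in>level n. height w) = n] (mod 2)"
proof (induction n)
  case 0
  have "(\<Sum>w\<in>level 0. height w) = 0" by (auto simp: level_def)
  then show ?case by simp
next
  case (Suc n)
  have "(s + 2 * h + 1) mod 2 = Suc n mod 2" if "s mod 2 = n mod 2" for s h :: nat
    using that by (simp add: One_nat_def mod_Suc)
  from this[OF Suc[unfolded cong_def]] show ?case
    unfolding sum_height_Suc cong_def .
qed

end

theorem theorem1:
  fixes W :: "nat \<Rightarrow> nat" and n :: nat
  assumes "binary_word W" and "sturmian W" and "n \<ge> 1"
  shows "[(\<Sum>w\<in>factors W n. height w) = n] (mod 2)"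
proof -
  interpret sturmian_word W by unfold_locales fact+
  show ?thesis using sum_height_cong[of n] by (simp only: level_eq_factors)
qed

end
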